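(* Let $d\ge 1$ and let $P\subset\mathbb{R}^d$ be a convex polytope with vertices in $\mathbb{Z}^d$. Suppose that $P$ multi-tiles $\mathbb{R}^d$ under the group $\mathcal{G}$, i.e. there is an integer $m$ such that $\sum_{g\in\mathcal{G}}1_P(gx)=m$ for almost every $x\in\mathbb{R}^d$. Then for every positive integer $n$, \[G_P(n)=\operatorname{vol}(P)\,G(n)^d .\]
   Context: $\mathcal{W}$ denotes the finite group of linear maps of $\mathbb{R}^d$ generated by the reflections in the coordinate hyperplanes and all permutations of the coordinates (so $|\mathcal{W}|=2^d d!$), and $\mathcal{G}$ is the group of maps of $\mathbb{R}^d$ generated by $\mathcal{W}$ and all translations by vectors of $\mathbb{Z}^d$. $1_P$ is the indicator function of $P$. For $x\in\mathbb{R}^d$, the solid angle $\omega_P(x)$ is $\operatorname{vol}(B(x,r)\cap P)/\operatorname{vol}(B(x,r))$ for all sufficiently small $r>0$ (so it is $1$ in the interior of $P$, $0$ outside $P$). Write $e(t)=e^{2\pi i t}$. The polyhedral Gauss sum is $G_P(n)=\sum_{x\in\mathbb{Z}^d}\omega_{nP}(x)\,e(\|x\|^2/n)$, where $nP$ is the dilate of $P$ by $n$, and $G(n)=\sum_{k\in\mathbb{Z}/n\mathbb{Z}}e(k^2/n)$ is the classical Gauss sum. *)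

theory Defs
  imports "HOL-Analysis.Analysis"
begin

definition int_lattice :: "(real^'d) set" where
  "int_lattice = {x. \<forall>i. x $ i \<in> \<int>}"

definition hyperoct :: "((real^'d) \<Rightarrow> (real^'d)) set" where
  "hyperoct = {(\<lambda>x. \<chi> i. s i * x $ (\<pi> i)) | s \<pi>.
       \<pi> permutes (UNIV :: 'd set) \<and> (\<forall>i. s i = 1 \<or> s i = -1)}"

definition affine_group :: "((real^'d) \<Rightarrow> (real^'d)) set" where
  "affine_group = {(\<lambda>x. w x + t) | w t. w \<in> hyperoct \<and> t \<in> int_lattice}"

text \<open>Solid angle of P at x: the (eventually constant) value of the relative
  volume of small balls around x.\<close>
definition solid_angle :: "(real^'d) set \<Rightarrow> real^'d \<Rightarrow> real" where
  "solid_angle P x = Lim (at_right 0)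
     (\<lambda>r. measure lebesgue (ball x r \<inter> P) / measure lebesgue (ball x r))"

definition ee :: "real \<Rightarrow> complex" where
  "ee t = exp (2 * pi * \<i> * complex_of_real t)"

definition poly_gauss_sum :: "(real^'d) set \<Rightarrow> nat \<Rightarrow> complex" where
  "poly_gauss_sum P n = infsum (\<lambda>x. complex_of_real (solid_angle ((\<lambda>y. real n *\<^sub>R y) ` P) x)
        * ee ((norm x)\<^sup>2 / real n)) int_lattice"

definition gauss_sum :: "nat \<Rightarrow> complex" where
  "gauss_sum n = (\<Sum>k<n. ee (real (k\<^sup>2) / real n))"

end

theory Submission
  imports Defs
begin

text \<open>
  By the tiling identity the sets \<open>w -` P\<close>, where \<open>w\<close> ranges over the hyperoctahedral group, jointly
  cover almost every point \<open>m\<close> times under integer translations alone. Averaging this over a unit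
  cube shows that their volumes add up to \<open>m\<close>. Averaging it over small balls around \<open>x\<close> gives an
  identity that holds at \<^emph>\<open>every\<close> \<open>x\<close>: the solid angles of all \<open>w -` P\<close> at all \<open>t + x\<close> with \<open>t\<close>
  integral add up to \<open>m\<close>. Since \<open>ee (\<bar>x\<bar>\<^sup>2 / n)\<close> depends only on the integral point \<open>x\<close> modulo
  \<open>n\<close>, writing \<open>x = n t + q\<close> with \<open>q\<close> in the cube \<open>[0, n)\<^sup>d\<close> shows that the Gauss sums of the
  \<open>w -` P\<close> add up to \<open>m\<close> times the sum of \<open>ee (\<bar>q\<bar>\<^sup>2 / n)\<close> over \<open>q\<close>, that is, to \<open>m G(n)\<^sup>d\<close>.
  Finally \<open>w\<close> is orthogonal and preserves the lattice, so every \<open>w -` P\<close> has the volume and the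
  Gauss sum of \<open>P\<close>.
\<close>

subsection \<open>Orthogonal transformations and Lebesgue measure\<close>

lemma orthogonal_vimage_eq_image_inv:
  fixes f :: "'a::euclidean_space \<Rightarrow> 'a"
  shows "orthogonal_transformation f \<Longrightarrow> f -` S = inv f ` S"
  by (simp add: bij_vimage_eq_inv_image orthogonal_transformation_bij)

lemma orthogonal_transformation_linear_inv:
  fixes f :: "'a::euclidean_space \<Rightarrow> 'a"
  shows "orthogonal_transformation f \<Longrightarrow> linear (inv f)"
  by (simp add: orthogonal_transformation_inv orthogonal_transformation_linear)

lemma orthogonal_vimage_ball:
  fixes f :: "'a::euclidean_space \<Rightarrow> 'a"
  assumes "orthogonal_transformation f"
  shows "f -` ball y r = ball (inv f y) r"
  using assms
  by (simp add: orthogonal_vimage_eq_image_inv orthogonal_transformation_inv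
      image_orthogonal_transformation_ball)

lemma compact_orthogonal_vimage:
  fixes f :: "'a::euclidean_space \<Rightarrow> 'a"
  assumes f: "orthogonal_transformation f" and "compact S"
  shows "compact (f -` S)"
  unfolding orthogonal_vimage_eq_image_inv[OF f]
  using assms orthogonal_transformation_linear_inv[OF f]
  by (intro compact_continuous_image linear_continuous_on)
    (simp_all add: linear_conv_bounded_linear)

lemma negligible_orthogonal_vimage:
  fixes f :: "'a::euclidean_space \<Rightarrow> 'a"
  assumes f: "orthogonal_transformation f" and "negligible N"
  shows "negligible (f -` N)"
  unfolding orthogonal_vimage_eq_image_inv[OF f]
  using assms orthogonal_transformation_linear_inv[OF f]
  by (intro negligible_differentiable_image_negligible linear_imp_differentiable_on) simp_all

lemma borel_measurable_orthogonal:
  fixes f :: "'a::euclidean_space \<Rightarrow> 'a"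
  assumes "orthogonal_transformation f"
  shows "f \<in> borel_measurable borel"
  using assms
  by (intro borel_measurable_continuous_onI linear_continuous_on)
    (simp add: linear_conv_bounded_linear[symmetric] orthogonal_transformation_linear)

lemma open_almost_disjoint_UN_balls:
  fixes S :: "'a::euclidean_space set"
  assumes "open S"
  obtains C where "countable C" "disjoint_family_on (\<lambda>p. ball (fst p) (snd p)) C"
    "(\<Union>p\<in>C. ball (fst p) (snd p)) \<subseteq> S" "negligible (S - (\<Union>p\<in>C. ball (fst p) (snd p)))"
proof -
  define K where "K = {(y, r). ball y r \<subseteq> S}"
  have "\<exists>p. p \<in> K \<and> x \<in> ball (fst p) (snd p) \<and> snd p < d" if "x \<in> S" "0 < d" for x d
  proof -
    obtain e where "e > 0" "ball x e \<subseteq> S"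
      using assms \<open>x \<in> S\<close> open_contains_ball by blast
    then have "(x, min e (d / 2)) \<in> K" "0 < min e (d / 2)" "min e (d / 2) < d"
      using \<open>0 < d\<close> by (auto simp: K_def)
    then show ?thesis by (metis centre_in_ball fst_conv snd_conv)
  qed
  then obtain C where "countable C" and C: "C \<subseteq> K"
    and disjoint: "pairwise (\<lambda>p q. disjnt (ball (fst p) (snd p)) (ball (fst q) (snd q))) C"
    and "negligible (S - (\<Union>p\<in>C. ball (fst p) (snd p)))"
    by (rule Vitali_covering_theorem_balls)
  moreover have "disjoint_family_on (\<lambda>p. ball (fst p) (snd p)) C"
    using disjoint by (simp add: disjoint_family_on_def pairwise_def disjnt_def)
  moreover have "(\<Union>p\<in>C. ball (fst p) (snd p)) \<subseteq> S"
    using C by (fastforce simp: K_def)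
  ultimately show thesis
    by (intro that)
qed

lemma emeasure_orthogonal_vimage_open:
  fixes f :: "'a::euclidean_space \<Rightarrow> 'a"
  assumes f: "orthogonal_transformation f" and S: "open S"
  shows "emeasure lebesgue (f -` S) = emeasure lebesgue S"
proof -
  let ?B = "\<lambda>p :: 'a \<times> real. ball (fst p) (snd p)"
  obtain C where C: "countable C" "disjoint_family_on ?B C" "(\<Union>p\<in>C. ?B p) \<subseteq> S"
    and rest: "negligible (S - (\<Union>p\<in>C. ?B p))"
    using open_almost_disjoint_UN_balls[OF S] .
  have decompose:
    "emeasure lebesgue (g -` S) = (\<integral>\<^sup>+p. emeasure lebesgue (g -` ?B p) \<partial>count_space C)"
    if g: "orthogonal_transformation g" for g :: "'a \<Rightarrow> 'a"
  proof -
    have ball_measurable: "g -` ?B p \<in> sets lebesgue" for p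
      by (simp add: orthogonal_vimage_ball[OF g])
    have "g -` S = (\<Union>p\<in>C. g -` ?B p) \<union> g -` (S - (\<Union>p\<in>C. ?B p))"
      using C(3) by blast
    moreover have "(\<Union>p\<in>C. g -` ?B p) \<in> sets lebesgue"
      using C(1) ball_measurable by (intro sets.countable_UN') auto
    ultimately have "emeasure lebesgue (g -` S) = emeasure lebesgue (\<Union>p\<in>C. g -` ?B p)"
      using negligible_orthogonal_vimage[OF g rest]
      by (simp only: emeasure_Un_null_set negligible_iff_null_sets)
    also have "\<dots> = (\<integral>\<^sup>+p. emeasure lebesgue (g -` ?B p) \<partial>count_space C)"
      using C(1) ball_measurable disjoint_family_on_vimageI[OF C(2), of g]
      by (intro emeasure_UN_countable)
    finally show ?thesis .
  qed
  have "emeasure lebesgue (f -` ?B p) = emeasure lebesgue (?B p)" for p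
    by (cases "snd p \<ge> 0") (simp_all add: orthogonal_vimage_ball[OF f] emeasure_ball ball_empty)
  then show ?thesis
    using decompose[OF f] decompose[OF orthogonal_transformation_id] by simp
qed

lemma lborel_distr_orthogonal:
  fixes f :: "'a::euclidean_space \<Rightarrow> 'a"
  assumes f: "orthogonal_transformation f"
  shows "distr lborel borel f = lborel"
proof (rule lborel_eqI[symmetric])
  fix l u :: 'a assume "\<And>b. b \<in> Basis \<Longrightarrow> l \<bullet> b \<le> u \<bullet> b"
  moreover have "emeasure lborel (f -` box l u) = emeasure lborel (box l u)"
    using emeasure_orthogonal_vimage_open[OF f open_box, of l u]
      measurable_sets[OF borel_measurable_orthogonal[OF f], of "box l u"]
    by simp
  ultimately show "emeasure (distr lborel borel f) (box l u) = (\<Prod>b\<in>Basis. (u - l) \<bullet> b)"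
    using borel_measurable_orthogonal[OF f] by (simp add: emeasure_distr)
qed simp

lemma measure_orthogonal_vimage:
  fixes f :: "'a::euclidean_space \<Rightarrow> 'a"
  assumes f: "orthogonal_transformation f" and S: "S \<in> sets borel"
  shows "measure lebesgue (f -` S) = measure lebesgue S"
proof -
  note f_measurable = borel_measurable_orthogonal[OF f]
  have "f -` S \<in> sets borel"
    using measurable_sets[OF f_measurable S] by simp
  moreover have "measure lborel (f -` S) = measure lborel S"
    using f_measurable S lborel_distr_orthogonal[OF f] measure_distr[of f lborel borel S] by simp
  ultimately show ?thesis
    using S by simp
qed

subsection \<open>The integer lattice and periodization\<close>

lemma int_lattice_add: "x \<in> int_lattice \<Longrightarrow> y \<in> int_lattice \<Longrightarrow> x + y \<in> int_lattice"
  and int_lattice_diff: "x \<in> int_lattice \<Longrightarrow> y \<in> int_lattice \<Longrightarrow> x - y \<in> int_lattice"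
  and int_lattice_scaleR: "c \<in> \<int> \<Longrightarrow> x \<in> int_lattice \<Longrightarrow> c *\<^sub>R x \<in> int_lattice"
  by (auto simp: int_lattice_def)

lemma int_lattice_inner: "x \<in> int_lattice \<Longrightarrow> y \<in> int_lattice \<Longrightarrow> x \<bullet> y \<in> \<int>"
  by (auto simp: inner_vec_def int_lattice_def)

lemma finite_int_lattice_Int_bounded:
  fixes S :: "(real^'d) set"
  assumes "bounded S"
  shows "finite (int_lattice \<inter> S)"
proof -
  obtain R where R: "\<And>x. x \<in> S \<Longrightarrow> norm x \<le> R"
    using assms by (auto simp: bounded_iff)
  have "int_lattice \<inter> S \<subseteq>
      (\<lambda>k. \<chi> i. of_int (k i)) ` (\<Pi>\<^sub>E i\<in>UNIV. {-\<lceil>R\<rceil>..\<lceil>R\<rceil>})"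
  proof
    fix x assume x: "x \<in> int_lattice \<inter> S"
    then have floor: "of_int \<lfloor>x $ i\<rfloor> = x $ i" for i
      by (auto simp: int_lattice_def)
    have "\<bar>of_int \<lfloor>x $ i\<rfloor>\<bar> \<le> R" for i
      unfolding floor using component_le_norm_cart[of x i] R x by force
    then have "-\<lceil>R\<rceil> \<le> \<lfloor>x $ i\<rfloor>" "\<lfloor>x $ i\<rfloor> \<le> \<lceil>R\<rceil>" for i
      by (smt (verit, best) le_of_int_ceiling of_int_le_iff of_int_minus)+
    then show "x \<in> (\<lambda>k. \<chi> i. of_int (k i)) ` (\<Pi>\<^sub>E i\<in>UNIV. {-\<lceil>R\<rceil>..\<lceil>R\<rceil>})"
      by (intro image_eqI[where x = "\<lambda>i. \<lfloor>x $ i\<rfloor>"]) (auto simp: vec_eq_iff floor)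
  qed
  then show ?thesis
    by (rule finite_subset) (intro finite_imageI finite_PiE; simp)
qed

definition transporter :: "(real^'d) set \<Rightarrow> (real^'d) set \<Rightarrow> (real^'d) set" where
  "transporter A B = {t \<in> int_lattice. (+) t ` A \<inter> B \<noteq> {}}"

lemma finite_transporter:
  fixes A B :: "(real^'d) set"
  assumes "bounded A" "bounded B"
  shows "finite (transporter A B)"
proof -
  have "transporter A B \<subseteq> int_lattice \<inter> (\<Union>b\<in>B. \<Union>a\<in>A. {b - a})"
    by (force simp: transporter_def)
  then show ?thesis
    using finite_int_lattice_Int_bounded[OF bounded_differences[OF assms(2,1)]]
    by (rule finite_subset)
qed

definition periodization :: "(real^'d \<Rightarrow> 'b::{comm_monoid_add, t2_space}) \<Rightarrow> real^'d \<Rightarrow> 'b" where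
  "periodization f x = (\<Sum>\<^sub>\<infinity>t\<in>int_lattice. f (t + x))"

lemma infsum_finite_neutral:
  fixes f :: "'a \<Rightarrow> 'b::{topological_comm_monoid_add, t2_space}"
  assumes "finite B" "B \<subseteq> A" "\<And>x. x \<in> A - B \<Longrightarrow> f x = 0"
  shows "infsum f A = sum f B"
  using assms by (intro infsumI has_sum_finite_neutralI) auto

lemma periodization_eq_sum:
  fixes f :: "real^'d \<Rightarrow> 'b::{topological_comm_monoid_add, t2_space}"
  assumes "bounded A" "bounded B" "\<And>y. y \<notin> B \<Longrightarrow> f y = 0" "x \<in> A"
  shows "periodization f x = (\<Sum>t\<in>transporter A B. f (t + x))"
  unfolding periodization_def
  using assms by (intro infsum_finite_neutral finite_transporter) (auto simp: transporter_def)

lemma periodization_linear_automorphism: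
  fixes f :: "real^'d \<Rightarrow> 'b::{comm_monoid_add, t2_space}"
  assumes w: "linear w" "bij_betw w int_lattice int_lattice"
  shows "periodization (\<lambda>y. f (w y)) x = periodization f (w x)"
  using infsum_reindex_bij_betw[OF w(2), of "\<lambda>t. f (t + w x)"]
  by (simp add: periodization_def linear_add[OF w(1)])

lemma infsum_measure_translates_eq_sum:
  fixes A B :: "(real^'d) set"
  assumes "bounded A" "bounded B"
  shows "(\<Sum>\<^sub>\<infinity>t\<in>int_lattice. measure lebesgue ((+) t ` A \<inter> B)) =
    (\<Sum>t\<in>transporter A B. measure lebesgue ((+) t ` A \<inter> B))"
  using assms by (intro infsum_finite_neutral finite_transporter) (auto simp: transporter_def)

lemma has_bochner_integral_periodization_indicator:
  fixes A B :: "(real^'d) set"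
  assumes A: "A \<in> lmeasurable" "bounded A" and B: "B \<in> lmeasurable" "bounded B"
  shows "has_bochner_integral lebesgue (\<lambda>x. indicator A x * periodization (indicator B) x)
    (\<Sum>\<^sub>\<infinity>t\<in>int_lattice. measure lebesgue ((+) t ` A \<inter> B))"
proof -
  have "has_bochner_integral lebesgue (\<lambda>x. indicator A x * indicator B (t + x) :: real)
      (measure lebesgue ((+) t ` A \<inter> B))" for t
  proof -
    let ?C = "A \<inter> (+) (- t) ` B"
    have "(\<lambda>x. indicator A x * indicator B (t + x) :: real) = indicator ?C"
      by (fastforce simp: fun_eq_iff indicator_def image_iff)
    moreover have "(+) t ` A \<inter> B = (+) t ` ?C"
      by (simp add: image_Int image_image)
    moreover have "?C \<in> lmeasurable"
      using A(1) B(1) by (intro fmeasurable.Int measurable_translation)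
    then have "has_bochner_integral lebesgue (indicator ?C) (measure lebesgue ?C)"
      by (intro has_bochner_integral_real_indicator) (auto simp: fmeasurable_def)
    ultimately show ?thesis
      by (simp only: measure_translation)
  qed
  then have "has_bochner_integral lebesgue
      (\<lambda>x. \<Sum>t\<in>transporter A B. indicator A x * indicator B (t + x))
      (\<Sum>t\<in>transporter A B. measure lebesgue ((+) t ` A \<inter> B))"
    by (rule has_bochner_integral_sum)
  moreover have "(\<Sum>t\<in>transporter A B. indicator A x * indicator B (t + x)) =
      indicator A x * (periodization (indicator B) x :: real)" for x
    using periodization_eq_sum[OF A(2) B(2), of "indicator B :: _ \<Rightarrow> real" x]
    by (auto simp: indicator_def sum_distrib_left)
  ultimately show ?thesis
    by (simp add: infsum_measure_translates_eq_sum[OF A(2) B(2)])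
qed

subsection \<open>Half-open cubes\<close>

definition half_open_cube :: "real \<Rightarrow> (real^'d) set" where
  "half_open_cube c = {x. \<forall>i. 0 \<le> x $ i \<and> x $ i < c}"

lemma half_open_cube_between:
  "box 0 (\<chi> i. c) \<subseteq> (half_open_cube c :: (real^'d) set)"
  "half_open_cube c \<subseteq> (cbox 0 (\<chi> i. c) :: (real^'d) set)"
  by (auto simp: half_open_cube_def mem_box_cart less_imp_le)

lemma bounded_half_open_cube: "bounded (half_open_cube c :: (real^'d) set)"
  using bounded_subset[OF bounded_cbox half_open_cube_between(2)] .

lemma lmeasurable_half_open_cube: "(half_open_cube c :: (real^'d) set) \<in> lmeasurable"
proof -
  have "half_open_cube c = (\<Inter>i. {x. 0 \<le> x $ i} \<inter> {x :: real^'d. x $ i < c})"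
    by (auto simp: half_open_cube_def)
  also have "\<dots> \<in> sets borel"
    by (intro sets.countable_INT' sets.Int borel_closed borel_open
        closed_halfspace_component_ge_cart open_halfspace_component_lt_cart) auto
  finally show ?thesis
    by (intro fmeasurableI2[OF lmeasurable_cbox half_open_cube_between(2)]) simp
qed

lemma measure_half_open_cube:
  assumes "c \<ge> 0"
  shows "measure lebesgue (half_open_cube c :: (real^'d) set) = c ^ CARD('d)"
proof -
  let ?c = "\<chi> i. c :: real^'d"
  have "measure lebesgue (half_open_cube c :: (real^'d) set) = measure lebesgue (cbox 0 ?c)"
    using half_open_cube_between[of c]
    by (intro measure_negligible_symdiff lmeasurable_cbox
        negligible_subset[OF negligible_frontier_interval]) auto
  also have "\<dots> = c ^ CARD('d)"
    using assms by (auto simp: content_cbox_cart interval_eq_empty_cart)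
  finally show ?thesis .
qed

lemma mem_translate_half_open_cube_iff:
  "x \<in> (+) a ` half_open_cube c \<longleftrightarrow> (\<forall>i. a $ i \<le> x $ i \<and> x $ i < a $ i + c)"
proof -
  have "x \<in> (+) a ` half_open_cube c \<longleftrightarrow> x - a \<in> half_open_cube c"
    by (auto intro!: image_eqI[where x = "x - a"])
  then show ?thesis
    by (auto simp: half_open_cube_def algebra_simps)
qed

lemma ex1_int_lattice_translate_half_open_cube:
  fixes x :: "real^'d"
  assumes "c > 0"
  shows "\<exists>!t. t \<in> int_lattice \<and> x \<in> (+) (c *\<^sub>R t) ` half_open_cube c"
proof -
  have "t \<in> int_lattice \<and> x \<in> (+) (c *\<^sub>R t) ` half_open_cube c \<longleftrightarrow> t = (\<chi> i. of_int \<lfloor>x $ i / c\<rfloor>)"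
    for t :: "real^'d"
  proof -
    have "t $ i \<in> \<int> \<and> c * t $ i \<le> x $ i \<and> x $ i < c * t $ i + c \<longleftrightarrow>
        t $ i = of_int \<lfloor>x $ i / c\<rfloor>" for i
    proof
      assume "t $ i \<in> \<int> \<and> c * t $ i \<le> x $ i \<and> x $ i < c * t $ i + c"
      then obtain k where k: "t $ i = of_int k" "of_int k \<le> x $ i / c" "x $ i / c < of_int k + 1"
        using assms by (auto simp: field_simps elim!: Ints_cases)
      then show "t $ i = of_int \<lfloor>x $ i / c\<rfloor>"
        by (simp add: floor_unique)
    next
      assume "t $ i = of_int \<lfloor>x $ i / c\<rfloor>"
      then show "t $ i \<in> \<int> \<and> c * t $ i \<le> x $ i \<and> x $ i < c * t $ i + c"
        using assms floor_divide_lower[of c "x $ i"] floor_divide_upper[of c "x $ i"]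
        by (simp add: algebra_simps)
    qed
    then show ?thesis
      by (simp add: mem_translate_half_open_cube_iff int_lattice_def vec_eq_iff all_conj_distrib)
        metis
  qed
  then show ?thesis by simp
qed

lemma infsum_measure_half_open_cube_translates:
  fixes B :: "(real^'d) set"
  assumes B: "B \<in> lmeasurable" "bounded B"
  shows "(\<Sum>\<^sub>\<infinity>t\<in>int_lattice. measure lebesgue ((+) t ` half_open_cube 1 \<inter> B)) = measure lebesgue B"
proof -
  let ?Q = "half_open_cube 1 :: (real^'d) set"
  let ?A = "\<lambda>t. (+) t ` ?Q \<inter> B"
  note tiling = ex1_int_lattice_translate_half_open_cube[of 1, simplified]
  have "(\<Sum>\<^sub>\<infinity>t\<in>int_lattice. measure lebesgue (?A t)) =
      (\<Sum>t\<in>transporter ?Q B. measure lebesgue (?A t))"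
    using bounded_half_open_cube B(2) by (rule infsum_measure_translates_eq_sum)
  also have "\<dots> = measure lebesgue (\<Union>t\<in>transporter ?Q B. ?A t)"
  proof (rule measure_UNION'[symmetric])
    show "finite (transporter ?Q B)"
      using bounded_half_open_cube B(2) by (rule finite_transporter)
    show "?A t \<in> lmeasurable" for t
      using B(1) lmeasurable_half_open_cube by (intro fmeasurable.Int measurable_translation)
    show "pairwise (\<lambda>s t. disjnt (?A s) (?A t)) (transporter ?Q B)"
      using tiling by (fastforce simp: pairwise_def disjnt_iff transporter_def)
  qed
  also have "(\<Union>t\<in>transporter ?Q B. ?A t) = B"
    using tiling by (fastforce simp: transporter_def)
  finally show ?thesis .
qed

subsection \<open>Solid angles of convex sets\<close>

definition ball_density :: "'a::euclidean_space set \<Rightarrow> 'a \<Rightarrow> real \<Rightarrow> real" where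
  "ball_density S x r = measure lebesgue (ball x r \<inter> S) / measure lebesgue (ball x r)"

lemma solid_angle_eq_Lim: "solid_angle P x = Lim (at_right 0) (ball_density P x)"
  unfolding solid_angle_def ball_density_def[abs_def] by (rule refl)

lemma ball_density_mono:
  assumes "S \<subseteq> T" "S \<in> sets lebesgue" "T \<in> sets lebesgue"
  shows "ball_density S x r \<le> ball_density T x r"
  unfolding ball_density_def using assms
  by (intro divide_right_mono measure_mono_fmeasurable fmeasurable_Int_fmeasurable) auto

lemma ball_density_le_1:
  assumes "S \<in> sets lebesgue"
  shows "ball_density S x r \<le> 1"
  using ball_density_mono[of S UNIV x r] assms by (auto simp: ball_density_def split: if_splits)

lemma ball_density_homothety:
  assumes "c > 0"
  shows "ball_density ((\<lambda>y. c *\<^sub>R y + a) ` S) (c *\<^sub>R x + a) (c * r) = ball_density S x r"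
proof -
  let ?h = "\<lambda>y. c *\<^sub>R y + a"
  have "?h ` ball x r = (+) a ` (*\<^sub>R) c ` ball x r"
    by (simp add: image_image add.commute)
  also have "\<dots> = ball (?h x) (c * r)"
    using assms by (simp add: ball_scale)
  finally have ball: "ball (?h x) (c * r) = ?h ` ball x r" ..
  have "inj ?h"
    using assms by (simp add: inj_def)
  then show ?thesis
    using assms by (simp add: ball_density_def ball measure_lebesgue_affine flip: image_Int)
qed

lemma ball_density_orthogonal_vimage:
  fixes f :: "'a::euclidean_space \<Rightarrow> 'a"
  assumes f: "orthogonal_transformation f" and S: "S \<in> sets borel"
  shows "ball_density (f -` S) x r = ball_density S (f x) r"
proof -
  have "ball x r = f -` ball (f x) r"
    using f orthogonal_transformation_inj[OF f] by (simp add: orthogonal_vimage_ball)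
  then show ?thesis
    using S by (simp add: ball_density_def measure_orthogonal_vimage[OF f] flip: vimage_Int)
qed

(* The homothety of ratio r / t centred at x maps the larger ball onto the smaller one and, by
   convexity, S into itself. *)
lemma convex_ball_density_antimono:
  assumes S: "convex S" "closed S" "x \<in> S" and r: "0 < r" "r \<le> t"
  shows "ball_density S x t \<le> ball_density S x r"
proof -
  define c where "c = r / t"
  have c: "0 < c" "c \<le> 1" "c * t = r"
    using r by (auto simp: c_def)
  define a where "a = (1 - c) *\<^sub>R x"
  let ?h = "\<lambda>y. c *\<^sub>R y + a"
  have fixed: "?h x = x"
    by (simp add: a_def algebra_simps)
  have "?h ` S \<subseteq> S"
    unfolding a_def using S c by (auto intro!: convexD)
  moreover have "closed ((+) a ` (*\<^sub>R) c ` S)"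
    using S(2) by (intro closed_translation closed_scaling)
  then have "closed (?h ` S)"
    by (simp add: image_image add.commute)
  ultimately have "ball_density (?h ` S) x r \<le> ball_density S x r"
    using S(2) by (intro ball_density_mono) auto
  then show ?thesis
    using ball_density_homothety[OF c(1), of a S x t] by (simp add: fixed c(3))
qed

lemma ball_density_eq_0: "ball x r \<inter> S = {} \<Longrightarrow> ball_density S x r = 0"
  by (simp only: ball_density_def measure_empty div_0)

lemma ball_density_tendsto_0:
  assumes "closed S" "x \<notin> S"
  shows "(ball_density S x \<longlongrightarrow> 0) (at_right 0)"
proof (rule tendsto_eventually)
  obtain e where e: "e > 0" "ball x e \<subseteq> - S"
    using assms open_contains_ball[of "- S"] by (auto simp: open_Compl)
  have "ball_density S x r = 0" if "r < e" for r
    using e(2) subset_ball[of r e x] that by (intro ball_density_eq_0) auto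
  then show "\<forall>\<^sub>F r in at_right 0. ball_density S x r = 0"
    using e(1) by (auto simp: eventually_at_right_field)
qed

lemma convex_ball_density_convergent:
  assumes "convex S" "closed S"
  obtains l where "(ball_density S x \<longlongrightarrow> l) (at_right 0)"
proof (cases "x \<in> S")
  case True
  then have "((\<lambda>r. - ball_density S x r) \<longlongrightarrow> Inf ((\<lambda>r. - ball_density S x r) ` ({0<..} \<inter> UNIV)))
      (at 0 within ({0<..} \<inter> UNIV))"
    using assms convex_ball_density_antimono ball_density_le_1[of S x]
    by (intro Lim_right_bound[where K = "-1"]) auto
  from tendsto_minus[OF this] show ?thesis
    using that by simp
qed (use assms that ball_density_tendsto_0 in blast)

lemma ball_density_tendsto_solid_angle:
  assumes "convex P" "closed P"
  shows "(ball_density P x \<longlongrightarrow> solid_angle P x) (at_right 0)"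
proof -
  obtain l where "(ball_density P x \<longlongrightarrow> l) (at_right 0)"
    using convex_ball_density_convergent[OF assms] .
  then show ?thesis
    using tendsto_Lim[of "at_right 0" "ball_density P x"] by (simp add: solid_angle_eq_Lim)
qed

lemma solid_angle_eq_0: "closed P \<Longrightarrow> x \<notin> P \<Longrightarrow> solid_angle P x = 0"
  unfolding solid_angle_eq_Lim by (intro tendsto_Lim ball_density_tendsto_0) simp_all

lemma solid_angle_orthogonal_vimage:
  fixes f :: "real^'d \<Rightarrow> real^'d"
  assumes "orthogonal_transformation f" "P \<in> sets borel"
  shows "solid_angle (f -` P) x = solid_angle P (f x)"
proof -
  have "ball_density (f -` P) x = ball_density P (f x)"
    by (rule ext) (rule ball_density_orthogonal_vimage[OF assms])
  then show ?thesis by (simp add: solid_angle_eq_Lim)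
qed

lemma solid_angle_scaleR:
  assumes c: "c > 0"
  shows "solid_angle ((*\<^sub>R) c ` P) x = solid_angle P (x /\<^sub>R c)"
proof -
  have "ball_density ((*\<^sub>R) c ` P) x (c * r) = ball_density P (x /\<^sub>R c) r" for r
    using ball_density_homothety[OF c, of 0 P "x /\<^sub>R c" r] c by simp
  then have "(ball_density ((*\<^sub>R) c ` P) x \<longlongrightarrow> l) (at_right 0) \<longleftrightarrow>
      (ball_density P (x /\<^sub>R c) \<longlongrightarrow> l) (at_right 0)" for l
    using filterlim_filtermap[of "ball_density ((*\<^sub>R) c ` P) x" "nhds l" "times c" "at_right 0"]
      filtermap_times_pos_at_right[OF c, of 0] by simp
  then show ?thesis
    by (simp add: solid_angle_eq_Lim Topological_Spaces.Lim_def)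
qed

lemma periodization_ball_density:
  "periodization (\<lambda>y. ball_density P y r) x =
    (\<Sum>\<^sub>\<infinity>t\<in>int_lattice. measure lebesgue ((+) t ` ball x r \<inter> P)) / measure lebesgue (ball x r)"
proof -
  have "measure lebesgue (ball (t + x) r) = measure lebesgue (ball x r)" for t
    using measure_translation[of t "ball x r"] by (simp only: image_add_ball add.commute)
  then show ?thesis
    by (simp add: periodization_def ball_density_def divide_inverse infsum_cmult_left' add.commute)
qed

lemma periodization_ball_density_tendsto:
  fixes P :: "(real^'d) set"
  assumes P: "convex P" "compact P"
  shows "((\<lambda>r. periodization (\<lambda>y. ball_density P y r) x)
    \<longlongrightarrow> periodization (solid_angle P) x) (at_right 0)"
proof -
  obtain a where a: "P \<subseteq> ball 0 a"
    using bounded_subset_ballD[OF compact_imp_bounded[OF P(2)]] by blast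
  define B :: "(real^'d) set" where "B = ball 0 (a + 1)"
  then have B: "bounded B"
    by simp
  have disjoint: "ball y r \<inter> P = {}" if "y \<notin> B" "r \<le> 1" for y r
  proof (rule equals0I)
    fix z assume "z \<in> ball y r \<inter> P"
    then have "norm z < a" "norm (y - z) < 1"
      using a \<open>r \<le> 1\<close> by (auto simp: dist_norm)
    then show False
      using \<open>y \<notin> B\<close> norm_triangle_sub[of y z] by (simp add: B_def)
  qed
  have "P \<subseteq> B"
    using a by (auto simp: B_def)
  then have "periodization (solid_angle P) x = (\<Sum>t\<in>transporter {x} B. solid_angle P (t + x))"
    using B P(2) by (intro periodization_eq_sum) (auto intro: solid_angle_eq_0 compact_imp_closed)
  moreover have "((\<lambda>r. \<Sum>t\<in>transporter {x} B. ball_density P (t + x) r) \<longlongrightarrow>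
      (\<Sum>t\<in>transporter {x} B. solid_angle P (t + x))) (at_right 0)"
    using P by (intro tendsto_sum ball_density_tendsto_solid_angle compact_imp_closed)
  moreover have "periodization (\<lambda>y. ball_density P y r) x =
      (\<Sum>t\<in>transporter {x} B. ball_density P (t + x) r)" if "r \<le> 1" for r
    using B disjoint that by (intro periodization_eq_sum) (auto intro: ball_density_eq_0)
  then have "\<forall>\<^sub>F r in at_right 0. (\<Sum>t\<in>transporter {x} B. ball_density P (t + x) r) =
      periodization (\<lambda>y. ball_density P y r) x"
    unfolding eventually_at_right_field by (intro exI[of _ 1]) auto
  ultimately show ?thesis
    by (simp add: filterlim_cong)
qed

subsection \<open>Multi-tilings by lattice translates\<close>

locale lattice_multitiling =
  fixes I :: "'i set" and P :: "'i \<Rightarrow> (real^'d) set" and m :: real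
  assumes convex_tile: "i \<in> I \<Longrightarrow> convex (P i)"
    and compact_tile: "i \<in> I \<Longrightarrow> compact (P i)"
    and multiplicity: "AE x in lborel. (\<Sum>i\<in>I. periodization (indicator (P i)) x) = m"
begin

lemma sum_measure_translates:
  assumes A: "A \<in> lmeasurable" "bounded A"
  shows "(\<Sum>i\<in>I. \<Sum>\<^sub>\<infinity>t\<in>int_lattice. measure lebesgue ((+) t ` A \<inter> P i)) = m * measure lebesgue A"
proof (rule has_bochner_integral_eq_AE)
  show "has_bochner_integral lebesgue (\<lambda>x. \<Sum>i\<in>I. indicator A x * periodization (indicator (P i)) x)
      (\<Sum>i\<in>I. \<Sum>\<^sub>\<infinity>t\<in>int_lattice. measure lebesgue ((+) t ` A \<inter> P i))"
    using A compact_tile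
    by (intro has_bochner_integral_sum has_bochner_integral_periodization_indicator)
      (auto intro: lmeasurable_compact compact_imp_bounded)
  show "has_bochner_integral lebesgue (\<lambda>x. m * indicator A x) (m * measure lebesgue A)"
    using A(1) by (intro has_bochner_integral_mult_right has_bochner_integral_real_indicator)
      (auto simp: fmeasurable_def)
  show "AE x in lebesgue.
      (\<Sum>i\<in>I. indicator A x * periodization (indicator (P i)) x) = m * indicator A x"
    using AE_completion[OF multiplicity] by eventually_elim (simp flip: sum_distrib_left)
qed

lemma sum_measure_eq_multiplicity: "(\<Sum>i\<in>I. measure lebesgue (P i)) = m"
proof -
  have "(\<Sum>i\<in>I. measure lebesgue (P i)) =
      (\<Sum>i\<in>I. \<Sum>\<^sub>\<infinity>t\<in>int_lattice. measure lebesgue ((+) t ` half_open_cube 1 \<inter> P i))"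
    using compact_tile
    by (intro sum.cong refl infsum_measure_half_open_cube_translates[symmetric])
      (auto intro: lmeasurable_compact compact_imp_bounded)
  then show ?thesis
    using sum_measure_translates[OF lmeasurable_half_open_cube bounded_half_open_cube, of 1]
    by (simp add: measure_half_open_cube)
qed

lemma sum_periodization_ball_density:
  assumes "r > 0"
  shows "(\<Sum>i\<in>I. periodization (\<lambda>y. ball_density (P i) y r) x) = m"
proof -
  have "measure lebesgue (ball x r) \<noteq> 0"
    using content_ball_pos[OF assms, of x] by simp
  then show ?thesis
    using sum_measure_translates[of "ball x r"]
    by (simp add: periodization_ball_density flip: sum_divide_distrib)
qed

lemma sum_periodization_solid_angle: "(\<Sum>i\<in>I. periodization (solid_angle (P i)) x) = m"
proof (rule tendsto_unique)
  let ?f = "\<lambda>r. \<Sum>i\<in>I. periodization (\<lambda>y. ball_density (P i) y r) x"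
  show "(?f \<longlongrightarrow> (\<Sum>i\<in>I. periodization (solid_angle (P i)) x)) (at_right 0)"
    by (intro tendsto_sum periodization_ball_density_tendsto convex_tile compact_tile)
  have "\<forall>\<^sub>F r in at_right 0. ?f r = m"
    using eventually_at_right_less by eventually_elim (rule sum_periodization_ball_density)
  then show "(?f \<longlongrightarrow> m) (at_right 0)"
    by (rule tendsto_eventually)
qed simp

end

subsection \<open>Polyhedral Gauss sums\<close>

lemma ee_add: "ee (s + t) = ee s * ee t"
  by (simp add: ee_def algebra_simps exp_add)

lemma ee_sum: "finite A \<Longrightarrow> ee (\<Sum>i\<in>A. f i) = (\<Prod>i\<in>A. ee (f i))"
  by (simp add: ee_def sum_distrib_left exp_sum)

lemma ee_Ints: "k \<in> \<int> \<Longrightarrow> ee k = 1"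
  using exp_integer_2pi[of k] by (simp add: ee_def mult_ac)

lemma ee_norm_periodic:
  fixes q t :: "real^'d"
  assumes "n > 0" "q \<in> int_lattice" "t \<in> int_lattice"
  shows "ee ((norm (real n *\<^sub>R t + q))\<^sup>2 / real n) = ee ((norm q)\<^sup>2 / real n)"
proof -
  have "(norm (real n *\<^sub>R t + q))\<^sup>2 / real n =
      (norm q)\<^sup>2 / real n + (2 * (q \<bullet> t) + real n * (t \<bullet> t))"
    using assms(1)
    by (simp add: power2_norm_eq_inner inner_add_left inner_add_right inner_commute field_simps)
  moreover have "2 * (q \<bullet> t) + real n * (t \<bullet> t) \<in> \<int>"
    using assms(2,3) by (intro Ints_add Ints_mult int_lattice_inner) simp_all
  ultimately show ?thesis
    by (simp only: ee_add[of "(norm q)\<^sup>2 / real n"] ee_Ints mult_1_right)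
qed

definition residue_vectors :: "nat \<Rightarrow> (real^'d) set" where
  "residue_vectors n = int_lattice \<inter> half_open_cube (real n)"

lemma finite_residue_vectors: "finite (residue_vectors n)"
  unfolding residue_vectors_def by (intro finite_int_lattice_Int_bounded bounded_half_open_cube)

lemma bij_betw_residue_vectors:
  "bij_betw (\<lambda>h. \<chi> i. real (h i)) (\<Pi>\<^sub>E i\<in>(UNIV :: 'd set). {..<n})
    (residue_vectors n :: (real^'d) set)"
proof (rule bij_betw_byWitness[where f' = "\<lambda>q i. nat \<lfloor>q $ i\<rfloor>"])
  have floor: "real (nat \<lfloor>q $ i\<rfloor>) = q $ i" if "q \<in> residue_vectors n" for q :: "real^'d" and i
    using that by (auto simp: residue_vectors_def int_lattice_def half_open_cube_def)
  then show "\<forall>q\<in>residue_vectors n. (\<chi> i. real (nat \<lfloor>q $ i\<rfloor>)) = (q :: real^'d)"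
    by (simp add: vec_eq_iff)
  have "nat \<lfloor>q $ i\<rfloor> < n" if "q \<in> residue_vectors n" for q :: "real^'d" and i
  proof -
    have "real (nat \<lfloor>q $ i\<rfloor>) < real n"
      using that unfolding floor[OF that] by (simp add: residue_vectors_def half_open_cube_def)
    then show ?thesis by simp
  qed
  then show "(\<lambda>q i. nat \<lfloor>q $ i\<rfloor>) ` (residue_vectors n :: (real^'d) set) \<subseteq> (\<Pi>\<^sub>E i\<in>UNIV. {..<n})"
    by auto
qed (auto simp: residue_vectors_def int_lattice_def half_open_cube_def)

lemma gauss_sum_power_CARD:
  "gauss_sum n ^ CARD('d) = (\<Sum>q\<in>(residue_vectors n :: (real^'d) set). ee ((norm q)\<^sup>2 / real n))"
proof -
  let ?F = "\<Pi>\<^sub>E i\<in>(UNIV :: 'd set). {..<n}"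
  have "gauss_sum n ^ CARD('d) = (\<Prod>i\<in>(UNIV :: 'd set). \<Sum>k<n. ee (real (k\<^sup>2) / real n))"
    by (simp add: gauss_sum_def)
  also have "\<dots> = (\<Sum>h\<in>?F. \<Prod>i\<in>UNIV. ee (real ((h i)\<^sup>2) / real n))"
    by (rule prod_sum_PiE) auto
  also have "\<dots> = (\<Sum>h\<in>?F. ee ((norm (\<chi> i. real (h i) :: real^'d))\<^sup>2 / real n))"
    by (simp add: norm_vec_def L2_set_def sum_nonneg sum_divide_distrib flip: ee_sum)
  also have "\<dots> = (\<Sum>q\<in>(residue_vectors n :: (real^'d) set). ee ((norm q)\<^sup>2 / real n))"
    by (rule sum.reindex_bij_betw[OF bij_betw_residue_vectors])
  finally show ?thesis .
qed

lemma bij_betw_residue_vectors_int_lattice: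
  assumes "n > 0"
  shows "bij_betw (\<lambda>(q, t). real n *\<^sub>R t + q) (residue_vectors n \<times> int_lattice)
    (int_lattice :: (real^'d) set)"
proof (rule bij_betw_imageI)
  let ?g = "\<lambda>(q, t). real n *\<^sub>R t + q :: real^'d"
  have unique: "\<exists>!t. t \<in> int_lattice \<and> x \<in> (+) (real n *\<^sub>R t) ` half_open_cube (real n)"
    for x :: "real^'d"
    using assms by (intro ex1_int_lattice_translate_half_open_cube) simp
  show "inj_on ?g (residue_vectors n \<times> int_lattice)"
  proof (rule inj_onI, clarify)
    fix q t q' t' :: "real^'d"
    assume "q \<in> residue_vectors n" "q' \<in> residue_vectors n" "t \<in> int_lattice" "t' \<in> int_lattice"
      and eq: "real n *\<^sub>R t + q = real n *\<^sub>R t' + q'"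
    then have "t = t'"
      using unique[of "real n *\<^sub>R t + q"] by (metis IntD2 imageI residue_vectors_def)
    then show "q = q' \<and> t = t'" using eq by simp
  qed
  have "x \<in> ?g ` (residue_vectors n \<times> int_lattice)" if "x \<in> int_lattice" for x
  proof -
    obtain t q where tq: "t \<in> int_lattice" "q \<in> half_open_cube (real n)" "x = real n *\<^sub>R t + q"
      using unique[of x] by auto
    have "x - real n *\<^sub>R t \<in> int_lattice"
      using tq(1) that by (intro int_lattice_diff int_lattice_scaleR) simp_all
    then have "q \<in> residue_vectors n"
      using tq by (simp add: residue_vectors_def)
    then show ?thesis
      unfolding tq(3) using tq(1) by (intro image_eqI[where x = "(q, t)"]) simp_all
  qed
  then show "?g ` (residue_vectors n \<times> int_lattice) = int_lattice"
    by (auto simp: residue_vectors_def int_lattice_add int_lattice_scaleR)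
qed

lemma infsum_int_lattice_residue_vectors:
  fixes f :: "real^'d \<Rightarrow> 'b::banach"
  assumes "n > 0" and "f summable_on int_lattice"
  shows "infsum f int_lattice = (\<Sum>q\<in>residue_vectors n. \<Sum>\<^sub>\<infinity>t\<in>int_lattice. f (real n *\<^sub>R t + q))"
proof -
  note bij = bij_betw_residue_vectors_int_lattice[OF assms(1), where 'd = 'd]
  have summable: "(\<lambda>(q, t). f (real n *\<^sub>R t + q)) summable_on residue_vectors n \<times> int_lattice"
    using summable_on_reindex_bij_betw[OF bij, of f] assms(2) by (simp add: case_prod_unfold)
  have "infsum f int_lattice = (\<Sum>\<^sub>\<infinity>(q, t)\<in>residue_vectors n \<times> int_lattice. f (real n *\<^sub>R t + q))"
    using infsum_reindex_bij_betw[OF bij, of f] by (simp add: case_prod_unfold)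
  also have "\<dots> = (\<Sum>q\<in>residue_vectors n. \<Sum>\<^sub>\<infinity>t\<in>int_lattice. f (real n *\<^sub>R t + q))"
    by (subst infsum_Sigma'_banach[OF summable, symmetric]) (simp add: finite_residue_vectors)
  finally show ?thesis .
qed

lemma infsum_complex_of_real:
  "(\<Sum>\<^sub>\<infinity>x\<in>A. complex_of_real (f x)) = complex_of_real (infsum f A)"
proof (rule infsum_bounded_linear_strong)
  show "(\<lambda>x. complex_of_real (f x)) summable_on A \<longleftrightarrow> f summable_on A"
    using summable_on_Re[of "\<lambda>x. complex_of_real (f x)" A] by (auto intro: summable_on_of_real)
qed (rule bounded_linear_of_real)

lemma poly_gauss_sum_eq_sum_residue_vectors:
  fixes P :: "(real^'d) set"
  assumes P: "compact P" and n: "n > 0"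
  shows "poly_gauss_sum P n =
    (\<Sum>q\<in>residue_vectors n.
      of_real (periodization (solid_angle P) (q /\<^sub>R real n)) * ee ((norm q)\<^sup>2 / real n))"
proof -
  define f where "f x = of_real (solid_angle P (x /\<^sub>R real n)) * ee ((norm x)\<^sup>2 / real n)" for x
  have "f x = 0" if "x \<notin> (*\<^sub>R) (real n) ` P" for x
  proof -
    have "x /\<^sub>R real n \<notin> P"
      using that n by (force simp: image_iff)
    then show ?thesis
      using P by (simp add: f_def solid_angle_eq_0 compact_imp_closed)
  qed
  then have "f summable_on int_lattice \<longleftrightarrow> f summable_on int_lattice \<inter> (*\<^sub>R) (real n) ` P"
    by (intro summable_on_cong_neutral) auto
  moreover have "finite (int_lattice \<inter> (*\<^sub>R) (real n) ` P)"
    using P by (intro finite_int_lattice_Int_bounded compact_imp_bounded compact_scaling)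
  ultimately have f_summable: "f summable_on int_lattice"
    by simp
  have "f (real n *\<^sub>R t + q) =
      of_real (solid_angle P (t + q /\<^sub>R real n)) * ee ((norm q)\<^sup>2 / real n)"
    if "q \<in> residue_vectors n" "t \<in> int_lattice" for q t
    using that n by (simp add: f_def ee_norm_periodic residue_vectors_def scaleR_right_distrib)
  then have "(\<Sum>\<^sub>\<infinity>t\<in>int_lattice. f (real n *\<^sub>R t + q)) =
      of_real (periodization (solid_angle P) (q /\<^sub>R real n)) * ee ((norm q)\<^sup>2 / real n)"
    if "q \<in> residue_vectors n" for q
    using that
    by (simp add: periodization_def infsum_cmult_left' flip: infsum_complex_of_real
        cong: infsum_cong)
  moreover have "poly_gauss_sum P n = infsum f int_lattice"
    using n by (simp add: poly_gauss_sum_def f_def[abs_def] solid_angle_scaleR)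
  ultimately show ?thesis
    using infsum_int_lattice_residue_vectors[OF n f_summable] by simp
qed

lemma poly_gauss_sum_orthogonal_vimage:
  fixes w :: "real^'d \<Rightarrow> real^'d"
  assumes w: "orthogonal_transformation w" "bij_betw w int_lattice int_lattice"
    and P: "P \<in> sets borel" and n: "n > 0"
  shows "poly_gauss_sum (w -` P) n = poly_gauss_sum P n"
proof -
  have "solid_angle (w -` P) (x /\<^sub>R real n) = solid_angle P (w x /\<^sub>R real n)" for x
    using w(1) P
    by (simp add: solid_angle_orthogonal_vimage orthogonal_transformation_linear linear_cmul)
  then show ?thesis
    using infsum_reindex_bij_betw[OF w(2),
        of "\<lambda>x. of_real (solid_angle P (x /\<^sub>R real n)) * ee ((norm x)\<^sup>2 / real n)"]
    by (simp add: poly_gauss_sum_def solid_angle_scaleR n orthogonal_transformation_norm[OF w(1)])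
qed

lemma (in lattice_multitiling) sum_poly_gauss_sum:
  assumes "n > 0"
  shows "(\<Sum>i\<in>I. poly_gauss_sum (P i) n) =
    of_real (\<Sum>i\<in>I. measure lebesgue (P i)) * gauss_sum n ^ CARD('d)"
proof -
  let ?e = "\<lambda>q :: real^'d. ee ((norm q)\<^sup>2 / real n)"
  let ?\<Omega> = "\<lambda>i. periodization (solid_angle (P i))"
  have "(\<Sum>i\<in>I. poly_gauss_sum (P i) n) =
      (\<Sum>i\<in>I. \<Sum>q\<in>residue_vectors n. of_real (?\<Omega> i (q /\<^sub>R real n)) * ?e q)"
    using assms by (simp add: poly_gauss_sum_eq_sum_residue_vectors compact_tile)
  also have "\<dots> = (\<Sum>q\<in>residue_vectors n. of_real (\<Sum>i\<in>I. ?\<Omega> i (q /\<^sub>R real n)) * ?e q)"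
    by (subst sum.swap) (simp add: sum_distrib_right)
  also have "\<dots> = of_real m * gauss_sum n ^ CARD('d)"
    by (simp add: sum_periodization_solid_angle gauss_sum_power_CARD sum_distrib_left)
  finally show ?thesis
    by (simp only: sum_measure_eq_multiplicity)
qed

subsection \<open>The hyperoctahedral group\<close>

lemma hyperoctE:
  assumes "w \<in> hyperoct"
  obtains s \<pi> where "w = (\<lambda>x. \<chi> i. s i * x $ (\<pi> i))" "\<pi> permutes UNIV" "\<And>i. s i = 1 \<or> s i = -1"
  using assms unfolding hyperoct_def by blast

lemma orthogonal_transformation_hyperoct:
  assumes "w \<in> hyperoct"
  shows "orthogonal_transformation w"
proof -
  obtain s \<pi> where w: "w = (\<lambda>x. \<chi> i. s i * x $ (\<pi> i))" and \<pi>: "\<pi> permutes UNIV"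
    and s: "\<And>i. s i = 1 \<or> s i = -1"
    using hyperoctE[OF assms] by blast
  have "linear w"
    by (auto intro!: linearI simp: w vec_eq_iff algebra_simps)
  moreover have "w x \<bullet> w y = x \<bullet> y" for x y
  proof -
    have sign_cancel: "s i * a * (s i * b) = a * b" for i and a b :: real
      using s[of i] by auto
    have "w x \<bullet> w y = (\<Sum>i\<in>UNIV. x $ \<pi> i * y $ \<pi> i)"
      by (simp add: w inner_vec_def sign_cancel)
    also have "\<dots> = x \<bullet> y"
      using sum.permute[OF \<pi>, of "\<lambda>i. x $ i * y $ i"] by (simp add: inner_vec_def o_def)
    finally show ?thesis .
  qed
  ultimately show ?thesis
    by (simp add: orthogonal_transformation_def)
qed

lemma hyperoct_mem_int_lattice_iff:
  assumes "w \<in> hyperoct"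
  shows "w x \<in> int_lattice \<longleftrightarrow> x \<in> int_lattice"
proof -
  obtain s \<pi> where w: "w = (\<lambda>x. \<chi> i. s i * x $ (\<pi> i))" and \<pi>: "\<pi> permutes UNIV"
    and s: "\<And>i. s i = 1 \<or> s i = -1"
    using hyperoctE[OF assms] by blast
  have "s i * y \<in> \<int> \<longleftrightarrow> y \<in> \<int>" for i and y :: real
    using s[of i] by auto
  then have "w x \<in> int_lattice \<longleftrightarrow> (\<forall>i. x $ \<pi> i \<in> \<int>)"
    by (simp add: w int_lattice_def)
  also have "\<dots> \<longleftrightarrow> (\<forall>i. x $ i \<in> \<int>)"
    using \<pi> by (metis permutes_univ)
  finally show ?thesis
    by (simp add: int_lattice_def)
qed

lemma bij_betw_hyperoct_int_lattice:
  assumes "w \<in> hyperoct"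
  shows "bij_betw w int_lattice int_lattice"
proof -
  have bij: "bij w"
    using assms by (simp add: orthogonal_transformation_hyperoct orthogonal_transformation_bij)
  have "w -` int_lattice = int_lattice"
    using assms by (auto simp: hyperoct_mem_int_lattice_iff)
  then have "w ` int_lattice = int_lattice"
    using surj_image_vimage_eq[OF bij_is_surj[OF bij], of int_lattice] by (simp only:)
  with bij show ?thesis
    by (rule bij_betw_subset[OF _ subset_UNIV])
qed

lemma finite_hyperoct: "finite (hyperoct :: ((real^'d) \<Rightarrow> (real^'d)) set)"
proof -
  have "hyperoct \<subseteq> (\<lambda>(s,\<pi>). (\<lambda>x::real^'d. \<chi> i. s i * x $ (\<pi> i))) `
      ((\<Pi>\<^sub>E i\<in>UNIV. {1,-1}) \<times> {\<pi>. \<pi> permutes UNIV})"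
    by (auto simp: hyperoct_def image_iff)
  then show ?thesis
    by (rule finite_subset) (auto intro!: finite_imageI finite_PiE finite_permutations)
qed

lemma id_in_hyperoct: "(\<lambda>x. x) \<in> hyperoct"
  unfolding hyperoct_def
  by (rule CollectI, rule exI[of _ "\<lambda>_. 1"], rule exI[of _ id]) (simp add: permutes_id)

lemma card_hyperoct_pos: "card (hyperoct :: ((real^'d) \<Rightarrow> (real^'d)) set) > 0"
  using finite_hyperoct id_in_hyperoct by (auto simp: card_gt_0_iff)

lemma bij_betw_affine_group:
  "bij_betw (\<lambda>(w, t). \<lambda>x. w x + t) (hyperoct \<times> int_lattice) affine_group"
proof (rule bij_betw_imageI)
  show "inj_on (\<lambda>(w, t). \<lambda>x. w x + t) (hyperoct \<times> int_lattice)"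
  proof (rule inj_onI, clarify)
    fix w w' :: "real^'d \<Rightarrow> real^'d" and t t'
    assume "w \<in> hyperoct" "w' \<in> hyperoct" and eq: "(\<lambda>x. w x + t) = (\<lambda>x. w' x + t')"
    then have "w 0 = 0" "w' 0 = 0"
      by (simp_all add: orthogonal_transformation_hyperoct orthogonal_transformation_linear
          linear_0)
    then have "t = t'"
      using fun_cong[OF eq, of 0] by simp
    then show "w = w' \<and> t = t'"
      using eq by (auto simp: fun_eq_iff)
  qed
qed (force simp: affine_group_def)

lemma infsum_affine_group:
  fixes f :: "real^'d \<Rightarrow> 'b::{topological_comm_monoid_add, t2_space}"
  assumes B: "bounded B" "\<And>y. y \<notin> B \<Longrightarrow> f y = 0"
  shows "(\<Sum>\<^sub>\<infinity>g\<in>affine_group. f (g x)) = (\<Sum>w\<in>hyperoct. periodization (\<lambda>y. f (w y)) x)"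
proof -
  define A where "A = (\<lambda>w. w x) ` (hyperoct :: (real^'d \<Rightarrow> real^'d) set)"
  have A: "bounded A" "\<And>w. w \<in> hyperoct \<Longrightarrow> w x \<in> A"
    using finite_hyperoct by (auto simp: A_def intro: finite_imp_bounded)
  have "(\<Sum>\<^sub>\<infinity>g\<in>affine_group. f (g x)) = (\<Sum>\<^sub>\<infinity>(w, t)\<in>hyperoct \<times> int_lattice. f (t + w x))"
    using infsum_reindex_bij_betw[OF bij_betw_affine_group, of "\<lambda>g. f (g x)"]
    by (simp add: case_prod_unfold add.commute)
  also have "\<dots> = (\<Sum>(w, t)\<in>hyperoct \<times> transporter A B. f (t + w x))"
    using A B finite_hyperoct finite_transporter[OF A(1) B(1)]
    by (intro infsum_finite_neutral) (auto simp: transporter_def)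
  also have "\<dots> = (\<Sum>w\<in>hyperoct. periodization f (w x))"
    using A B by (simp add: periodization_eq_sum flip: sum.cartesian_product)
  also have "\<dots> = (\<Sum>w\<in>hyperoct. periodization (\<lambda>y. f (w y)) x)"
    by (intro sum.cong refl periodization_linear_automorphism[symmetric]
        bij_betw_hyperoct_int_lattice orthogonal_transformation_linear
        orthogonal_transformation_hyperoct)
  finally show ?thesis .
qed

lemma lattice_multitiling_hyperoct:
  fixes P :: "(real^'d) set"
  assumes P: "convex P" "compact P"
    and tile: "AE x in lborel. (\<Sum>\<^sub>\<infinity>g\<in>affine_group. indicator P (g x)) = m"
  shows "lattice_multitiling hyperoct (\<lambda>w. w -` P) m"
proof
  fix w :: "real^'d \<Rightarrow> real^'d" assume "w \<in> hyperoct"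
  then have w: "orthogonal_transformation w"
    by (rule orthogonal_transformation_hyperoct)
  then show "convex (w -` P)"
    using P(1) by (intro convex_linear_vimage orthogonal_transformation_linear)
  show "compact (w -` P)"
    using w P(2) by (rule compact_orthogonal_vimage)
next
  have "indicator (w -` P) = (\<lambda>y. indicator P (w y) :: real)" for w :: "real^'d \<Rightarrow> real^'d"
    by (simp add: fun_eq_iff indicator_def)
  then show "AE x in lborel. (\<Sum>w\<in>hyperoct. periodization (indicator (w -` P)) x) = m"
    using tile infsum_affine_group[OF compact_imp_bounded[OF P(2)], of "indicator P :: _ \<Rightarrow> real"]
    by simp
qed

theorem theorem1:
  fixes P :: "(real^'d) set" and n :: nat
  assumes "polytope P"
    and "\<forall>v. v extreme_point_of P \<longrightarrow> v \<in> int_lattice"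
    and "\<exists>m::int. AE x in lborel.
           (\<Sum>\<^sub>\<infinity>g\<in>affine_group. indicator P (g x) :: real) = real_of_int m"
    and "n > 0"
  shows "poly_gauss_sum P n = complex_of_real (measure lebesgue P) * gauss_sum n ^ CARD('d)"
proof -
  let ?W = "hyperoct :: (real^'d \<Rightarrow> real^'d) set"
  have P: "convex P" "compact P"
    using assms(1) by (simp_all add: polytope_imp_convex polytope_imp_compact)
  then have P_borel: "P \<in> sets borel"
    by (simp add: borel_compact)
  obtain m :: int where "lattice_multitiling ?W (\<lambda>w. w -` P) m"
    using assms(3) lattice_multitiling_hyperoct[OF P] by blast
  then have "(\<Sum>w\<in>?W. poly_gauss_sum (w -` P) n) =
      of_real (\<Sum>w\<in>?W. measure lebesgue (w -` P)) * gauss_sum n ^ CARD('d)"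
    using assms(4) by (rule lattice_multitiling.sum_poly_gauss_sum)
  moreover have "poly_gauss_sum (w -` P) n = poly_gauss_sum P n" if "w \<in> ?W" for w
    using that P_borel assms(4)
    by (intro poly_gauss_sum_orthogonal_vimage orthogonal_transformation_hyperoct
        bij_betw_hyperoct_int_lattice)
  moreover have "measure lebesgue (w -` P) = measure lebesgue P" if "w \<in> ?W" for w
    using that P_borel by (intro measure_orthogonal_vimage orthogonal_transformation_hyperoct)
  ultimately have "of_nat (card ?W) * poly_gauss_sum P n =
      of_nat (card ?W) * (complex_of_real (measure lebesgue P) * gauss_sum n ^ CARD('d))"
    by simp
  then show ?thesis
    using card_hyperoct_pos[where 'd = 'd] by simp
qed

end
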